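(* Let $(X,d)$ be a compact metric space, $T:X\to X$ continuous, and $A\in C^0(X)$. (I) Let $\varphi\in C^0(X,\mathbb R^n)$ and $h\in\varphi_*(\mathcal M_T)$. Let $\{\varphi_j\}\subset C^0(X,\mathbb R^n)$ be a sequence converging to $\varphi$ in the sup norm, and let $\{h_j\}\subset\mathbb R^n$ be a sequence satisfying $h_j\in(\varphi_j)_*(m_{A,\varphi}(h))$ for all $j$. Then $\lim_{j\to\infty}\beta_{A,\varphi_j}(h_j)=\beta_{A,\varphi}(h)$. (II) For every $c\in\mathbb R^n$, the map $\varphi\in C^0(X,\mathbb R^n)\mapsto\alpha_{A,\varphi}(c)\in\mathbb R$ is Lipschitz, with Lipschitz constant $\mathrm{Lip}(\alpha_{A,\cdot}(c))\le\|c\|$.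
   Context: $\mathcal M_T$ is the set of $T$-invariant Borel probability measures on $X$. For $\psi=(\psi_1,\dots,\psi_n)\in C^0(X,\mathbb R^n)$ (a "constraint"), $\psi_*:\mathcal M_T\to\mathbb R^n$ is $\psi_*(\mu)=\left(\int\psi_1\,d\mu,\dots,\int\psi_n\,d\mu\right)$, and $\psi_*^{-1}(h)=\{\mu\in\mathcal M_T:\psi_*(\mu)=h\}$. For $h\in\psi_*(\mathcal M_T)$, the beta function is $\beta_{A,\psi}(h)=\sup\{\int A\,d\mu:\mu\in\psi_*^{-1}(h)\}$, and $m_{A,\psi}(h)=\{\mu\in\psi_*^{-1}(h):\int A\,d\mu=\beta_{A,\psi}(h)\}$. The alpha function is $\alpha_{A,\psi}(c)=\min_{h\in\psi_*(\mathcal M_T)}[\langle c,h\rangle-\beta_{A,\psi}(h)]$ for $c\in\mathbb R^n$. $\langle\cdot,\cdot\rangle$ and $\|\cdot\|$ are the Euclidean inner product and norm on $\mathbb R^n$, and $C^0(X,\mathbb R^n)$ carries the norm $\|\varphi\|_0=\sup_{x\in X}\|\varphi(x)\|$. *)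

theory Defs
  imports "HOL-Probability.Probability"
begin

text \<open>
  On a compact space every continuous function is bounded, so \<open>C\<^sup>0(X, \<real>\<^sup>n)\<close> with the sup norm is the
  library type of bounded continuous functions; the codomain \<open>real ^ 'n\<close> carries the Euclidean norm.
\<close>

definition invariant_measures :: "('a::topological_space \<Rightarrow> 'a) \<Rightarrow> 'a measure set" where
  "invariant_measures T =
     {\<mu>. sets \<mu> = sets borel \<and> prob_space \<mu> \<and> distr \<mu> borel T = \<mu>}"

definition constraint_map ::
    "('a::topological_space \<Rightarrow>\<^sub>C (real ^ 'n)) \<Rightarrow> 'a measure \<Rightarrow> real ^ 'n" where
  "constraint_map \<psi> \<mu> = (\<chi> i. \<integral>x. apply_bcontfun \<psi> x $ i \<partial>\<mu>)"

definition constraint_fibre ::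
    "('a::topological_space \<Rightarrow> 'a) \<Rightarrow> ('a \<Rightarrow>\<^sub>C (real ^ 'n)) \<Rightarrow> real ^ 'n \<Rightarrow> 'a measure set" where
  "constraint_fibre T \<psi> h = {\<mu> \<in> invariant_measures T. constraint_map \<psi> \<mu> = h}"

text \<open>The value is meaningful only for \<open>h\<close> in the image of \<open>constraint_map \<psi>\<close>.\<close>

definition beta_fun ::
    "('a::topological_space \<Rightarrow> 'a) \<Rightarrow> ('a \<Rightarrow>\<^sub>C real) \<Rightarrow> ('a \<Rightarrow>\<^sub>C (real ^ 'n)) \<Rightarrow> real ^ 'n \<Rightarrow> real" where
  "beta_fun T A \<psi> h = (SUP \<mu>\<in>constraint_fibre T \<psi> h. \<integral>x. apply_bcontfun A x \<partial>\<mu>)"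

definition maximizing_measures ::
    "('a::topological_space \<Rightarrow> 'a) \<Rightarrow> ('a \<Rightarrow>\<^sub>C real) \<Rightarrow> ('a \<Rightarrow>\<^sub>C (real ^ 'n)) \<Rightarrow> real ^ 'n
      \<Rightarrow> 'a measure set" where
  "maximizing_measures T A \<psi> h =
     {\<mu> \<in> constraint_fibre T \<psi> h. (\<integral>x. apply_bcontfun A x \<partial>\<mu>) = beta_fun T A \<psi> h}"

text \<open>
  The minimum of a possibly infinite set of reals is its least element, hence \<open>LEAST\<close>: \<open>Min\<close> is
  specified for finite sets only, and an infimum need not be attained.
\<close>

definition alpha_fun ::
    "('a::topological_space \<Rightarrow> 'a) \<Rightarrow> ('a \<Rightarrow>\<^sub>C real) \<Rightarrow> ('a \<Rightarrow>\<^sub>C (real ^ 'n)) \<Rightarrow> real ^ 'n \<Rightarrow> real" where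
  "alpha_fun T A \<psi> c =
     (LEAST r. r \<in> (\<lambda>h. c \<bullet> h - beta_fun T A \<psi> h) ` (constraint_map \<psi> ` invariant_measures T))"

end

theory Submission
  imports Defs
begin

text \<open>
  Both parts rest on the weak-* sequential compactness of the set of invariant measures; the rest is
  the estimate that, for an invariant probability measure, replacing one constraint by another moves
  its value by at most the sup distance of the constraints (\<open>constraint_map_dist_le\<close>).

  Part (I). The measures \<open>\<mu>\<^sub>j\<close> that produce \<open>h\<^sub>j\<close> lie in the fibre of \<open>\<phi>\<^sub>j\<close> over \<open>h\<^sub>j\<close> and have
  \<open>A\<close>-integral \<open>\<beta>(h)\<close>, so every perturbed beta value is at least \<open>\<beta>(h)\<close>. If infinitely many
  exceeded \<open>\<beta>(h) + e\<close>, almost optimal measures in those fibres would accumulate at an invariant measure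
  \<open>\<nu>'\<close> with \<open>A\<close>-integral above \<open>\<beta>(h)\<close>. By the estimate \<open>h\<^sub>j \<rightarrow> h\<close>, and also \<open>\<nu>'\<close> has constraint
  value \<open>h\<close>, which contradicts the definition of \<open>\<beta>(h)\<close> (\<open>beta_fun_tendsto\<close>).

  Part (II). Merging the minimum over \<open>h\<close> with the supremum in \<open>\<beta>\<close> gives
  \<open>\<alpha>(c) = min\<^sub>\<mu> (\<langle>c, \<phi>\<^sub>*(\<mu>)\<rangle> - \<integral>A d\<mu>)\<close>, attained by compactness (\<open>alpha_fun_variational\<close>). For fixed
  \<open>\<mu>\<close> the expression is \<open>\<parallel>c\<parallel>\<close>-Lipschitz in \<open>\<phi>\<close> by Cauchy-Schwarz and the estimate, and a minimum of
  Lipschitz functions with a common constant has that constant.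

  Compactness is reduced to Helly's selection theorem on the real line. A ternary code of the open sets
  containing a point embeds the space in the reals by a Borel map \<open>g\<close> which has a left inverse \<open>\<pi>\<close>
  that is continuous on a compact set containing the codes (\<open>compact_metric_Borel_section\<close>). Push the
  measures forward by \<open>g\<close>, select a weakly convergent subsequence there, and push its limit back by
  \<open>\<pi>\<close> (\<open>weakly_convergent_subsequence\<close>). Invariance survives in the limit because it is tested by
  continuous functions.
\<close>

section \<open>Sequential compactness of the probability measures on a compact metric space\<close>

text \<open>
  At the first differing digit, of index \<open>m\<close>, the two expansions drift apart by \<open>3\<^sup>-\<^sup>m\<close>, whereas
  all later digits together can only make up for half of that. Base 3 with digits 0 and 1 is what makes
  nearby values share a long prefix; in base 2 carries would destroy this.
\<close>

lemma ternary_expansion_separates: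
  fixes a b :: "nat \<Rightarrow> bool"
  assumes "k < N" and "a k \<noteq> b k"
  shows "1 / (2 * 3 ^ N) < \<bar>(\<Sum>i. of_bool (a i) / 3 ^ i) - (\<Sum>i. of_bool (b i) / (3::real) ^ i)\<bar>"
proof -
  define d :: "nat \<Rightarrow> real" where "d i = of_bool (a i) / 3 ^ i - of_bool (b i) / 3 ^ i" for i
  define m where "m = (LEAST i. a i \<noteq> b i)"
  have m: "a m \<noteq> b m" "m \<le> k"
    unfolding m_def using LeastI[of "\<lambda>i. a i \<noteq> b i", OF assms(2)] Least_le[of "\<lambda>i. a i \<noteq> b i", OF assms(2)] by blast+
  have before: "d i = 0" if "i < m" for i
    using not_less_Least[of i "\<lambda>i. a i \<noteq> b i"] that by (simp add: d_def m_def)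
  have geo: "summable (\<lambda>i. (1/3 :: real) ^ i)" by (simp add: summable_geometric)
  have summ: "summable (\<lambda>i. of_bool (c i) / (3::real) ^ i)" for c
    by (rule summable_comparison_test'[OF geo, of 0]) (auto simp: power_divide)
  have d_summ: "summable d"
    unfolding d_def by (intro summable_diff summ)
  have d_le: "\<bar>d i\<bar> \<le> (1/3) ^ i" for i
    by (auto simp: d_def power_divide)
  have split: "(\<Sum>i. d i) = (\<Sum>i. d (i + Suc m)) + d m"
  proof -
    have "(\<Sum>i<Suc m. d i) = d m" by (simp add: before)
    then show ?thesis using suminf_split_initial_segment[OF d_summ, of "Suc m"] by simp
  qed
  have tail: "\<bar>\<Sum>i. d (i + Suc m)\<bar> \<le> (1/3) ^ m / 2"
  proof -
    have 1: "summable (\<lambda>i. (1/3 :: real) ^ (i + Suc m))"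
      using geo summable_iff_shift[of "\<lambda>i. (1/3 :: real) ^ i"] by blast
    have 2: "summable (\<lambda>i. \<bar>d (i + Suc m)\<bar>)"
      by (rule summable_comparison_test'[OF 1, of 0]) (simp only: real_norm_def abs_abs d_le)
    have "\<bar>\<Sum>i. d (i + Suc m)\<bar> \<le> (\<Sum>i. \<bar>d (i + Suc m)\<bar>)"
      by (rule summable_rabs[OF 2])
    also have "\<dots> \<le> (\<Sum>i. (1/3 :: real) ^ (i + Suc m))"
      by (intro suminf_le 1 2 d_le)
    also have "\<dots> = (1/3 :: real) ^ Suc m * (\<Sum>i. (1/3) ^ i)"
      using suminf_mult[OF geo, of "(1/3) ^ Suc m"] by (simp add: power_add mult.commute)
    also have "\<dots> = (1/3) ^ m / 2"
      by (simp add: suminf_geometric)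
    finally show ?thesis .
  qed
  have head: "\<bar>d m\<bar> = (1/3) ^ m"
    using m(1) by (auto simp: d_def power_divide)
  have "1 / (2 * 3 ^ N) < (1 / 3 :: real) ^ m / 2"
    using m(2) assms(1) by (simp add: power_divide field_simps power_strict_increasing)
  also have "\<dots> \<le> \<bar>\<Sum>i. d i\<bar>"
    using tail head unfolding split by linarith
  also have "(\<Sum>i. d i) = (\<Sum>i. of_bool (a i) / 3 ^ i) - (\<Sum>i. of_bool (b i) / (3::real) ^ i)"
    unfolding d_def by (rule suminf_diff[OF summ summ, symmetric])
  finally show ?thesis .
qed

text \<open>
  Enumerate the balls of radius \<open>1/(n+1)\<close> around finite nets, over all \<open>n\<close>. Each point lies in some ball
  of the \<open>n\<close>-th net, and these finitely many balls have bounded index, so agreement on an initial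
  segment puts both points into one small ball.
\<close>

lemma compact_countable_open_small_cover:
  assumes "compact (UNIV :: 'a::metric_space set)"
  obtains U :: "nat \<Rightarrow> 'a::metric_space set"
  where "\<And>k. open (U k)"
    and "\<And>e. e > 0 \<Longrightarrow> \<exists>N. \<forall>x y. (\<forall>k<N. x \<in> U k \<longleftrightarrow> y \<in> U k) \<longrightarrow> dist x y < e"
proof -
  have "\<exists>F. finite F \<and> (\<Union>x\<in>F. ball x (1 / real (Suc n))) = (UNIV :: 'a set)" for n
  proof -
    have "1 / real (Suc n) > 0" by simp
    then obtain F where "finite F" "UNIV \<subseteq> (\<Union>x\<in>F. ball (x :: 'a) (1 / real (Suc n)))"
      using seq_compact_imp_totally_bounded[OF compact_imp_seq_compact[OF assms]] by meson
    then show ?thesis by blast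
  qed
  then obtain F where F: "\<And>n. finite (F n)"
    "\<And>n. (\<Union>x\<in>F n. ball x (1 / real (Suc n))) = (UNIV :: 'a set)"
    by metis
  define B where "B = (\<Union>n. (\<lambda>x. ball x (1 / real (Suc n))) ` F n)"
  have "countable B"
    unfolding B_def using F(1) by (intro countable_UN countable_image) (auto intro: countable_finite)
  moreover have "B \<noteq> {}"
    using F(2)[of 0] unfolding B_def by blast
  ultimately have range: "range (from_nat_into B) = B"
    by (simp add: range_from_nat_into)
  show ?thesis
  proof (rule that[of "from_nat_into B"])
    fix k
    have "from_nat_into B k \<in> B" using range by blast
    then show "open (from_nat_into B k)" by (auto simp: B_def)
  next
    fix e :: real assume "e > 0"
    then obtain n where n: "1 / real (Suc n) < e / 2"
      by (metis half_gt_zero nat_approx_posE)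
    define C where "C = (\<lambda>x. ball x (1 / real (Suc n))) ` F n"
    have "finite C" "C \<subseteq> range (from_nat_into B)"
      unfolding range using F(1) by (auto simp: C_def B_def)
    then obtain I where I: "finite I" "C = from_nat_into B ` I"
      by (meson finite_subset_image)
    show "\<exists>N. \<forall>x y. (\<forall>k<N. x \<in> from_nat_into B k \<longleftrightarrow> y \<in> from_nat_into B k) \<longrightarrow> dist x y < e"
    proof (intro exI allI impI)
      fix x y assume xy: "\<forall>k<Suc (Max I). x \<in> from_nat_into B k \<longleftrightarrow> y \<in> from_nat_into B k"
      obtain z where z: "z \<in> F n" "x \<in> ball z (1 / real (Suc n))"
        using F(2)[of n] by blast
      then obtain k where k: "k \<in> I" "ball z (1 / real (Suc n)) = from_nat_into B k"
        using I(2) unfolding C_def by blast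
      then have "k < Suc (Max I)" using I(1) by (simp add: le_imp_less_Suc)
      then have "y \<in> ball z (1 / real (Suc n))" using xy k z by auto
      with z(2) n show "dist x y < e"
        by (smt (verit) dist_commute dist_triangle mem_ball field_sum_of_halves)
    qed
  qed
qed

text \<open>
  The coding map \<open>g\<close> is in general discontinuous, but by the two preceding lemmas its inverse is uniformly
  continuous on the range. The compact set \<open>K\<close> has to contain limits of codes, so \<open>\<pi>\<close> extends this
  inverse: the closure of the graph of \<open>g\<close> is compact and, by uniformity, still projects injectively
  to the code coordinate; inverting the projection gives \<open>\<pi>\<close>.
\<close>

lemma compact_metric_Borel_section:
  assumes "compact (UNIV :: 'a::metric_space set)"
  obtains g :: "'a::metric_space \<Rightarrow> real" and \<pi> :: "real \<Rightarrow> 'a" and K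
  where "g \<in> borel_measurable borel" and "compact K" and "continuous_on K \<pi>"
    and "\<And>x. g x \<in> K" and "\<And>x. \<pi> (g x) = x"
proof -
  obtain U :: "nat \<Rightarrow> 'a set" where U: "\<And>k. open (U k)"
    "\<And>e. e > 0 \<Longrightarrow> \<exists>N. \<forall>x y. (\<forall>k<N. x \<in> U k \<longleftrightarrow> y \<in> U k) \<longrightarrow> dist x y < e"
    using compact_countable_open_small_cover[OF assms] by metis
  define g :: "'a \<Rightarrow> real" where "g x = (\<Sum>k. of_bool (x \<in> U k) / 3 ^ k)" for x
  have g_meas: "g \<in> borel_measurable borel"
  proof -
    have [measurable]: "U k \<in> sets borel" for k using U(1) by simp
    have *: "g = (\<lambda>x. \<Sum>k. indicator (U k) x / 3 ^ k)"
      by (simp add: g_def fun_eq_iff indicator_def)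
    show ?thesis unfolding * by measurable
  qed
  have g_range: "g x \<in> {0..2}" for x
  proof -
    have geo: "summable (\<lambda>i. (1/3 :: real) ^ i)" by (simp add: summable_geometric)
    have s: "summable (\<lambda>k. of_bool (x \<in> U k) / (3::real) ^ k)"
      by (rule summable_comparison_test'[OF geo, of 0]) (auto simp: power_divide)
    have "g x \<le> (\<Sum>k. (1/3) ^ k)"
      unfolding g_def by (intro suminf_le s geo) (auto simp: power_divide)
    moreover have "0 \<le> g x"
      unfolding g_def by (intro suminf_nonneg s) auto
    ultimately show ?thesis by (simp add: suminf_geometric)
  qed
  have sep: "\<exists>\<delta>>0. \<forall>x y. \<bar>g x - g y\<bar> < \<delta> \<longrightarrow> dist x y < e" if e: "e > 0" for e
  proof -
    obtain N where N: "\<And>x y. (\<forall>k<N. x \<in> U k \<longleftrightarrow> y \<in> U k) \<Longrightarrow> dist x y < e"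
      using U(2)[OF e] by blast
    have "dist x y < e" if "\<bar>g x - g y\<bar> < 1 / (2 * 3 ^ N)" for x y
      using ternary_expansion_separates[of _ N "\<lambda>k. x \<in> U k" "\<lambda>k. y \<in> U k"] that
      unfolding g_def by (intro N) fastforce
    then show ?thesis by (intro exI[of _ "1 / (2 * 3 ^ N)"]) simp
  qed
  define G where "G = closure (range (\<lambda>x. (g x, x)))"
  have "G \<subseteq> {0..2} \<times> UNIV"
    unfolding G_def
    by (rule closure_minimal) (use g_range in \<open>auto intro: closed_Times\<close>)
  moreover have "compact ({0..2::real} \<times> (UNIV :: 'a set))"
    using assms by (intro compact_Times) auto
  ultimately have "compact G"
    by (metis G_def closed_closure compact_Int_closed inf.absorb_iff2)
  have inj: "inj_on fst G"
  proof (rule inj_onI, clarsimp)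
    fix t x y assume G: "(t, x) \<in> G" "(t, y) \<in> G"
    show "x = y"
    proof (rule ccontr)
      assume "x \<noteq> y"
      define e where "e = dist x y / 3"
      have "e > 0" using \<open>x \<noteq> y\<close> by (simp add: e_def)
      then obtain \<delta> where \<delta>: "\<delta> > 0" "\<And>u v. \<bar>g u - g v\<bar> < \<delta> \<Longrightarrow> dist u v < e"
        using sep by meson
      define r where "r = min (\<delta> / 2) e"
      have r: "r > 0" "r \<le> \<delta> / 2" "r \<le> e" using \<open>e > 0\<close> \<delta>(1) by (auto simp: r_def)
      obtain u where u: "dist (g u, u) (t, x) < r"
        using G(1) \<open>r > 0\<close> unfolding G_def closure_approachable by blast
      obtain v where v: "dist (g v, v) (t, y) < r"
        using G(2) \<open>r > 0\<close> unfolding G_def closure_approachable by blast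
      have "dist (g u) t < r" "dist u x < r" "dist (g v) t < r" "dist v y < r"
        using u v dist_fst_le[of "(g u, u)" "(t, x)"] dist_snd_le[of "(g u, u)" "(t, x)"]
          dist_fst_le[of "(g v, v)" "(t, y)"] dist_snd_le[of "(g v, v)" "(t, y)"] by auto
      moreover from this have "dist u v < e"
        using r by (intro \<delta>(2)) (auto simp: dist_real_def)
      moreover have "dist x y \<le> dist u x + dist u v + dist v y"
        by (metis add.commute add_mono_thms_linordered_semiring(3) dist_commute dist_triangle dist_triangle2 order_trans)
      ultimately show False using r by (simp add: e_def)
    qed
  qed
  show ?thesis
  proof (rule that[of g "fst ` G" "\<lambda>t. snd (the_inv_into G fst t)"])
    show "compact (fst ` G)"
      by (intro compact_continuous_image continuous_intros \<open>compact G\<close>)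
    show "continuous_on (fst ` G) (\<lambda>t. snd (the_inv_into G fst t))"
      by (intro continuous_on_snd continuous_on_inv_into continuous_intros \<open>compact G\<close> inj)
    fix x
    have "(g x, x) \<in> G" unfolding G_def by (rule subsetD[OF closure_subset]) auto
    then show "g x \<in> fst ` G" by force
    show "snd (the_inv_into G fst (g x)) = x"
      using the_inv_into_f_f[OF inj \<open>(g x, x) \<in> G\<close>] by simp
  qed (rule g_meas)
qed

text \<open>
  The codes stay in the compact set \<open>K\<close>, so the pushed forward laws are tight and their weak limit is
  concentrated on \<open>K\<close>, the closed set where \<open>\<pi>\<close> is continuous. Tietze's theorem turns a continuous
  \<open>f \<circ> \<pi>\<close> on \<open>K\<close> into a bounded test function on the whole line.
\<close>

lemma weakly_convergent_subsequence:
  fixes \<mu> :: "nat \<Rightarrow> 'a::metric_space measure"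
  assumes X: "compact (UNIV :: 'a set)"
    and \<mu>: "\<And>j. prob_space (\<mu> j)" "\<And>j. sets (\<mu> j) = sets borel"
  obtains r \<nu> where "strict_mono (r :: nat \<Rightarrow> nat)" "prob_space \<nu>" "sets \<nu> = sets borel"
    and "\<And>f :: 'a \<Rightarrow> real. continuous_on UNIV f \<Longrightarrow>
           (\<lambda>j. \<integral>x. f x \<partial>\<mu> (r j)) \<longlonglongrightarrow> (\<integral>x. f x \<partial>\<nu>)"
proof -
  obtain g :: "'a \<Rightarrow> real" and \<pi> K where g: "g \<in> borel_measurable borel"
    and K: "compact K" and \<pi>: "continuous_on K \<pi>"
    and gK: "\<And>x. g x \<in> K" and \<pi>g: "\<And>x. \<pi> (g x) = x"
    using compact_metric_Borel_section[OF X] by metis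
  have gm[measurable]: "g \<in> measurable (\<mu> j) borel" for j
    using g \<mu>(2) measurable_cong_sets by blast
  have Km[measurable]: "K \<in> sets borel"
    using K by (simp add: borel_closed compact_imp_closed)
  define \<kappa> where "\<kappa> j = distr (\<mu> j) borel g" for j
  have \<kappa>: "real_distribution (\<kappa> j)" for j
    unfolding \<kappa>_def using \<mu>(1)[of j]
    by (simp add: real_distribution_def real_distribution_axioms_def prob_space.prob_space_distr)
  have "tight \<kappa>"
  proof -
    obtain B where B: "\<And>t. t \<in> K \<Longrightarrow> norm t \<le> B" "B > 0"
      using compact_imp_bounded[OF K] bounded_pos by metis
    have "measure (\<kappa> j) {- B - 1<..B} = 1" for j
    proof -
      have "g -` {- B - 1<..B} \<inter> space (\<mu> j) = space (\<mu> j)"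
      proof -
        have "- B - 1 < g x \<and> g x \<le> B" for x
          using B(1)[OF gK[of x]] unfolding real_norm_def by linarith
        then show ?thesis by auto
      qed
      then show ?thesis
        unfolding \<kappa>_def using \<mu>(1)[of j] by (simp add: measure_distr prob_space.prob_space)
    qed
    moreover have "- B - 1 < B" using B(2) by simp
    ultimately show ?thesis
      unfolding tight_def using \<kappa> by (metis diff_gt_0_iff_gt diff_diff_eq2 less_add_same_cancel1 add.commute)
  qed
  then obtain r M where r: "strict_mono r" and M: "real_distribution M"
    and conv: "weak_conv_m (\<kappa> \<circ> id \<circ> r) M"
    using tight_imp_convergent_subsubsequence strict_mono_id by metis
  interpret M: real_distribution M by (rule M)
  have lim: "(\<lambda>j. \<integral>t. f t \<partial>\<kappa> (r j)) \<longlonglongrightarrow> (\<integral>t. f t \<partial>M)"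
    if "continuous_on UNIV f" "\<And>t. \<bar>f t\<bar> \<le> B" for f :: "real \<Rightarrow> real" and B
  proof -
    have "isCont f t" for t using that(1) by (simp add: continuous_on_eq_continuous_at)
    then show ?thesis
      using weak_conv_imp_integral_bdd_continuous_conv[OF _ M conv, of f B] \<kappa> that(2)
      by (auto simp: o_def)
  qed
  have lift: "(\<integral>t. f t \<partial>\<kappa> j) = (\<integral>x. f (g x) \<partial>\<mu> j)" if "f \<in> borel_measurable borel"
    for f :: "real \<Rightarrow> real" and j
    unfolding \<kappa>_def using that by (intro integral_distr) auto
  \<comment> \<open>The truncated distance to \<open>K\<close> has integral 0 along the sequence, hence also in the limit.\<close>
  have inK: "AE t in M. t \<in> K"
  proof -
    define f where "f t = min 1 (infdist t K)" for t
    have f_cont: "continuous_on UNIV f" unfolding f_def by (intro continuous_intros)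
    have f_bdd: "0 \<le> f t" "f t \<le> 1" for t by (auto simp: f_def infdist_nonneg)
    have fm[measurable]: "f \<in> borel_measurable borel"
      by (rule borel_measurable_continuous_onI[OF f_cont])
    have "(\<lambda>j. \<integral>t. f t \<partial>\<kappa> (r j)) \<longlonglongrightarrow> (\<integral>t. f t \<partial>M)"
      by (rule lim[OF f_cont, of 1]) (use f_bdd in \<open>auto simp: abs_le_iff intro: order_trans[of _ 0]\<close>)
    moreover have "(\<integral>t. f t \<partial>\<kappa> j) = 0" for j
      unfolding lift[OF fm] by (simp add: f_def gK)
    ultimately have "(\<integral>t. f t \<partial>M) = 0"
      by (simp add: LIMSEQ_const_iff)
    moreover have "integrable M f"
      by (rule M.integrable_const_bound[of _ 1]) (use f_bdd in auto)
    ultimately have "AE t in M. f t = 0"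
      using integral_nonneg_eq_0_iff_AE[of M f] f_bdd by simp
    then show ?thesis
    proof (rule AE_mp, intro AE_I2 impI)
      fix t assume "f t = 0"
      then have "infdist t K = 0" unfolding f_def by linarith
      moreover have "K \<noteq> {}" using gK by blast
      ultimately show "t \<in> K"
        using in_closed_iff_infdist_zero[OF compact_imp_closed[OF K]] by simp
    qed
  qed
  \<comment> \<open>The value off \<open>K\<close> is arbitrary: it is taken on a null set and only has to keep \<open>p\<close> Borel.\<close>
  define p where "p t = (if t \<in> K then \<pi> t else undefined)" for t
  have pm: "p \<in> measurable borel borel"
    unfolding p_def using \<pi>
    by (subst measurable_If_restrict_space_iff)
       (auto intro!: borel_measurable_continuous_on_restrict)
  then have pm'[measurable]: "p \<in> measurable M borel"
    by simp
  define \<nu> where "\<nu> = distr M borel p"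
  show ?thesis
  proof (rule that[of r \<nu>])
    show "prob_space \<nu>" unfolding \<nu>_def by (rule M.prob_space_distr) simp
    show "sets \<nu> = sets borel" by (simp add: \<nu>_def)
    fix f :: "'a \<Rightarrow> real" assume f: "continuous_on UNIV f"
    have fm[measurable]: "f \<in> borel_measurable borel"
      by (rule borel_measurable_continuous_onI[OF f])
    have "bounded (range f)"
      using compact_imp_bounded[OF compact_continuous_image[OF f X]] .
    then obtain B where B: "B > 0" "\<And>x. \<bar>f x\<bar> \<le> B"
      unfolding bounded_pos by auto
    have "continuous_on K (\<lambda>t. f (\<pi> t))"
      by (rule continuous_on_compose2[OF f \<pi>]) simp
    then obtain F where F: "continuous_on UNIV F" "\<And>t. t \<in> K \<Longrightarrow> F t = f (\<pi> t)"
      "\<And>t. \<bar>F t\<bar> \<le> B"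
      using Tietze[of K "\<lambda>t. f (\<pi> t)" UNIV B] B compact_imp_closed[OF K] by auto
    have Fm[measurable]: "F \<in> borel_measurable borel"
      by (rule borel_measurable_continuous_onI[OF F(1)])
    have "(\<lambda>j. \<integral>t. F t \<partial>\<kappa> (r j)) \<longlonglongrightarrow> (\<integral>t. F t \<partial>M)"
      by (rule lim[OF F(1) F(3)])
    moreover have "(\<integral>t. F t \<partial>\<kappa> j) = (\<integral>x. f x \<partial>\<mu> j)" for j
      unfolding lift[OF Fm] by (simp add: F(2)[OF gK] \<pi>g)
    moreover have "(\<integral>t. F t \<partial>M) = (\<integral>x. f x \<partial>\<nu>)"
    proof -
      have "(\<integral>x. f x \<partial>\<nu>) = (\<integral>t. f (p t) \<partial>M)"
        unfolding \<nu>_def by (rule integral_distr) auto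
      also have "\<dots> = (\<integral>t. F t \<partial>M)"
      proof (rule integral_cong_AE)
        show "AE t in M. f (p t) = F t"
          using inK by (auto simp: p_def F(2))
      qed simp_all
      finally show ?thesis by simp
    qed
    ultimately show "(\<lambda>j. \<integral>x. f x \<partial>\<mu> (r j)) \<longlonglongrightarrow> (\<integral>x. f x \<partial>\<nu>)" by simp
  qed (rule r)
qed

section \<open>Invariance passes to the limit\<close>

text \<open>
  The indicator of a closed set is the decreasing limit of continuous functions of the distance to it,
  and closed sets form an intersection-stable generator of the Borel sets.
\<close>

lemma prob_measure_eqI_continuous:
  fixes M N :: "'a::metric_space measure"
  assumes "prob_space M" "prob_space N" "sets M = sets borel" "sets N = sets borel"
    and eq: "\<And>f :: 'a \<Rightarrow> real. continuous_on UNIV f \<Longrightarrow> bounded (range f) \<Longrightarrow>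
      (\<integral>x. f x \<partial>M) = (\<integral>x. f x \<partial>N)"
  shows "M = N"
proof -
  interpret M: prob_space M by fact
  interpret N: prob_space N by fact
  have closed_eq: "emeasure M C = emeasure N C" if "closed C" for C
  proof (cases "C = {}")
    case False
    define f :: "nat \<Rightarrow> 'a \<Rightarrow> real" where "f n x = max 0 (1 - real n * infdist x C)" for n x
    have f_cont: "continuous_on UNIV (f n)" for n
      unfolding f_def by (intro continuous_intros)
    have f_bdd: "\<bar>f n x\<bar> \<le> 1" for n x
      by (auto simp: f_def infdist_nonneg)
    have f_lim: "(\<lambda>n. f n x) \<longlonglongrightarrow> indicator C x" for x
    proof (cases "x \<in> C")
      case True
      then show ?thesis by (simp add: f_def)
    next
      case False
      then have "infdist x C > 0"
        using in_closed_iff_infdist_zero[OF that \<open>C \<noteq> {}\<close>] infdist_nonneg[of x C]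
        by (metis less_eq_real_def)
      then obtain m where m: "1 < real m * infdist x C"
        using ex_less_of_nat_mult by blast
      have "f n x = 0" if "n \<ge> m" for n
      proof -
        have "real m * infdist x C \<le> real n * infdist x C"
          using that by (simp add: mult_right_mono infdist_nonneg)
        then show ?thesis using m by (simp add: f_def)
      qed
      then have "\<forall>\<^sub>F n in sequentially. f n x = indicator C x"
        using False by (auto simp: eventually_sequentially)
      then show ?thesis by (rule tendsto_eventually)
    qed
    have conv: "(\<lambda>n. \<integral>x. f n x \<partial>P) \<longlonglongrightarrow> measure P C"
      if P: "prob_space P" "sets P = sets borel" for P
    proof -
      interpret P: prob_space P by fact
      have [measurable]: "f n \<in> borel_measurable P" for n
        using borel_measurable_continuous_onI[OF f_cont] P(2) measurable_cong_sets by blast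
      have [measurable]: "C \<in> sets P" using P(2) \<open>closed C\<close> by simp
      have "(\<lambda>n. \<integral>x. f n x \<partial>P) \<longlonglongrightarrow> (\<integral>x. indicator C x \<partial>P)"
        by (rule integral_dominated_convergence[where w = "\<lambda>_. 1"]) (use f_lim f_bdd in auto)
      then show ?thesis by simp
    qed
    have "(\<integral>x. f n x \<partial>M) = (\<integral>x. f n x \<partial>N)" for n
      by (rule eq[OF f_cont]) (use f_bdd in \<open>auto simp: bounded_iff\<close>)
    then have "measure M C = measure N C"
      using LIMSEQ_unique[OF conv[OF assms(1,3)]] conv[OF assms(2,4)] by simp
    then show ?thesis by (simp add: M.emeasure_eq_measure N.emeasure_eq_measure)
  qed simp
  have borel: "sets (borel :: 'a measure) = sigma_sets UNIV (Collect closed)"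
    by (subst borel_eq_closed) simp
  show ?thesis
    by (rule measure_eqI_generator_eq[where E = "Collect closed" and \<Omega> = UNIV and A = "\<lambda>_. UNIV"])
       (auto simp: assms(3,4) borel closed_eq Int_stable_def closed_Int)
qed

lemma invariant_measures_integral_comp:
  fixes f :: "'a::topological_space \<Rightarrow> real"
  assumes "\<mu> \<in> invariant_measures T" "continuous_on UNIV T" "continuous_on UNIV f"
  shows "(\<integral>x. f (T x) \<partial>\<mu>) = (\<integral>x. f x \<partial>\<mu>)"
proof -
  have s: "sets \<mu> = sets borel" and d: "distr \<mu> borel T = \<mu>"
    using assms(1) by (auto simp: invariant_measures_def)
  have "T \<in> measurable \<mu> borel"
    using borel_measurable_continuous_onI[OF assms(2)] s measurable_cong_sets by blast
  then show ?thesis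
    using integral_distr[of T \<mu> borel f] borel_measurable_continuous_onI[OF assms(3)] d by simp
qed

lemma invariant_measures_convergent_subsequence:
  fixes T :: "'a::metric_space \<Rightarrow> 'a"
  assumes X: "compact (UNIV :: 'a set)" and T: "continuous_on UNIV T"
    and \<mu>: "\<And>j. \<mu> j \<in> invariant_measures T"
  shows "\<exists>r \<nu>. strict_mono (r :: nat \<Rightarrow> nat) \<and> \<nu> \<in> invariant_measures T \<and>
    (\<forall>f :: 'a \<Rightarrow> real. continuous_on UNIV f \<longrightarrow>
       (\<lambda>j. \<integral>x. f x \<partial>\<mu> (r j)) \<longlonglongrightarrow> (\<integral>x. f x \<partial>\<nu>))"
proof -
  obtain r \<nu> where r: "strict_mono (r :: nat \<Rightarrow> nat)"
    and \<nu>: "prob_space \<nu>" "sets \<nu> = sets borel"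
    and lim: "\<And>f :: 'a \<Rightarrow> real. continuous_on UNIV f \<Longrightarrow>
           (\<lambda>j. \<integral>x. f x \<partial>\<mu> (r j)) \<longlonglongrightarrow> (\<integral>x. f x \<partial>\<nu>)"
    using weakly_convergent_subsequence[OF X, of \<mu>] \<mu> unfolding invariant_measures_def by blast
  have Tm: "T \<in> measurable \<nu> borel"
    using borel_measurable_continuous_onI[OF T] \<nu>(2) measurable_cong_sets by blast
  have "distr \<nu> borel T = \<nu>"
  proof (rule prob_measure_eqI_continuous)
    show "prob_space (distr \<nu> borel T)" using prob_space.prob_space_distr[OF \<nu>(1) Tm] .
    fix f :: "'a \<Rightarrow> real" assume f: "continuous_on UNIV f"
    have "continuous_on UNIV (\<lambda>x. f (T x))"
      by (rule continuous_on_compose2[OF f T]) simp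
    then have "(\<lambda>j. \<integral>x. f (T x) \<partial>\<mu> (r j)) \<longlonglongrightarrow> (\<integral>x. f (T x) \<partial>\<nu>)"
      by (rule lim)
    then have "(\<lambda>j. \<integral>x. f x \<partial>\<mu> (r j)) \<longlonglongrightarrow> (\<integral>x. f (T x) \<partial>\<nu>)"
      by (simp add: invariant_measures_integral_comp[OF \<mu> T f])
    then have "(\<integral>x. f (T x) \<partial>\<nu>) = (\<integral>x. f x \<partial>\<nu>)"
      using LIMSEQ_unique lim[OF f] by blast
    then show "(\<integral>x. f x \<partial>distr \<nu> borel T) = (\<integral>x. f x \<partial>\<nu>)"
      using integral_distr[OF Tm borel_measurable_continuous_onI[OF f]] by simp
  qed (use \<nu> in auto)
  with \<nu> have "\<nu> \<in> invariant_measures T" by (simp add: invariant_measures_def)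
  with r lim show ?thesis by blast
qed

section \<open>Constraint maps and beta functions\<close>

lemma bcontfun_integrable:
  fixes f :: "'a::topological_space \<Rightarrow>\<^sub>C ('b::euclidean_space)"
  assumes "\<mu> \<in> invariant_measures T"
  shows "integrable \<mu> (apply_bcontfun f)"
proof -
  interpret prob_space \<mu> using assms by (simp add: invariant_measures_def)
  have s: "sets \<mu> = sets borel" using assms by (simp add: invariant_measures_def)
  have "apply_bcontfun f \<in> borel_measurable \<mu>"
    using borel_measurable_continuous_onI[OF continuous_on_apply_bcontfun] s measurable_cong_sets
    by blast
  then show ?thesis
    by (intro integrable_const_bound[of _ "norm f"]) (auto simp: norm_bounded)
qed

lemma bcontfun_integral_norm_diff_le:
  fixes f g :: "'a::topological_space \<Rightarrow>\<^sub>C ('b::euclidean_space)"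
  assumes "\<mu> \<in> invariant_measures T"
  shows "norm ((\<integral>x. apply_bcontfun f x \<partial>\<mu>) - (\<integral>x. apply_bcontfun g x \<partial>\<mu>)) \<le> dist f g"
proof -
  interpret prob_space \<mu> using assms by (simp add: invariant_measures_def)
  note int = bcontfun_integrable[OF assms]
  have "norm (\<integral>x. apply_bcontfun f x - apply_bcontfun g x \<partial>\<mu>)
      \<le> (\<integral>x. norm (apply_bcontfun f x - apply_bcontfun g x) \<partial>\<mu>)"
    by (rule integral_norm_bound)
  also have "\<dots> \<le> (\<integral>x. dist f g \<partial>\<mu>)"
    by (intro integral_mono integrable_norm Bochner_Integration.integrable_diff int)
       (auto simp: dist_bounded simp flip: dist_norm)
  finally show ?thesis by (simp add: int prob_space)
qed

text \<open>
  Passing from the coordinatewise integrals to one vector-valued integral bounds the Euclidean norm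
  directly, without a factor depending on the dimension.
\<close>

lemma constraint_map_eq_integral:
  assumes "\<mu> \<in> invariant_measures T"
  shows "constraint_map \<psi> \<mu> = (\<integral>x. apply_bcontfun \<psi> x \<partial>\<mu>)"
proof -
  have "(\<integral>x. apply_bcontfun \<psi> x $ i \<partial>\<mu>) = (\<integral>x. apply_bcontfun \<psi> x \<partial>\<mu>) $ i" for i
    by (rule integral_bounded_linear[OF bounded_linear_vec_nth bcontfun_integrable[OF assms]])
  then show ?thesis by (simp add: constraint_map_def vec_eq_iff)
qed

lemma constraint_map_dist_le:
  assumes "\<mu> \<in> invariant_measures T"
  shows "dist (constraint_map \<phi> \<mu>) (constraint_map \<psi> \<mu>) \<le> dist \<phi> \<psi>"
  using bcontfun_integral_norm_diff_le[OF assms, of \<phi> \<psi>]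
  by (simp add: constraint_map_eq_integral[OF assms] dist_norm)

lemma invariant_measures_convergent_subsequence_bcontfun:
  fixes T :: "'a::metric_space \<Rightarrow> 'a" and A :: "'a \<Rightarrow>\<^sub>C real" and \<psi> :: "'a \<Rightarrow>\<^sub>C (real ^ 'n)"
  assumes "compact (UNIV :: 'a set)" "continuous_on UNIV T"
    and "\<And>j. \<mu> j \<in> invariant_measures T"
  shows "\<exists>r \<nu>. strict_mono (r :: nat \<Rightarrow> nat) \<and> \<nu> \<in> invariant_measures T \<and>
    (\<lambda>j. \<integral>x. apply_bcontfun A x \<partial>\<mu> (r j)) \<longlonglongrightarrow> (\<integral>x. apply_bcontfun A x \<partial>\<nu>) \<and>
    (\<lambda>j. constraint_map \<psi> (\<mu> (r j))) \<longlonglongrightarrow> constraint_map \<psi> \<nu>"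
proof -
  obtain r \<nu> where r: "strict_mono (r :: nat \<Rightarrow> nat)" "\<nu> \<in> invariant_measures T"
    and lim: "\<And>f :: 'a \<Rightarrow> real. continuous_on UNIV f \<Longrightarrow>
           (\<lambda>j. \<integral>x. f x \<partial>\<mu> (r j)) \<longlonglongrightarrow> (\<integral>x. f x \<partial>\<nu>)"
    using invariant_measures_convergent_subsequence[where \<mu> = \<mu>, OF assms] by blast
  have "(\<lambda>j. constraint_map \<psi> (\<mu> (r j))) \<longlonglongrightarrow> constraint_map \<psi> \<nu>"
    unfolding constraint_map_def
    by (intro tendsto_vec_lambda lim continuous_intros continuous_on_apply_bcontfun)
  then show ?thesis using r lim[OF continuous_on_apply_bcontfun] by blast
qed

lemma integral_le_beta_fun:
  fixes A :: "'a::topological_space \<Rightarrow>\<^sub>C real"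
  assumes "\<mu> \<in> constraint_fibre T \<psi> h"
  shows "(\<integral>x. apply_bcontfun A x \<partial>\<mu>) \<le> beta_fun T A \<psi> h"
  unfolding beta_fun_def
proof (rule cSUP_upper[OF assms], rule bdd_aboveI2)
  fix \<nu> assume "\<nu> \<in> constraint_fibre T \<psi> h"
  then have "\<nu> \<in> invariant_measures T" by (simp add: constraint_fibre_def)
  from bcontfun_integral_norm_diff_le[OF this, of A 0]
  show "(\<integral>x. apply_bcontfun A x \<partial>\<nu>) \<le> norm A" by simp
qed

section \<open>Continuity of the beta function along maximizing measures\<close>

text \<open>
  The lower bound holds for each single \<open>j\<close>, because a maximizing measure for \<open>h\<close> lies in the perturbed
  fibre. The upper bound needs compactness: a perturbed fibre can contain measures of larger \<open>A\<close>-integral,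
  and only their limits are known to lie in the fibre over \<open>h\<close>.
\<close>

lemma beta_fun_tendsto:
  fixes T :: "'a::metric_space \<Rightarrow> 'a" and A :: "'a \<Rightarrow>\<^sub>C real"
    and \<phi> :: "'a \<Rightarrow>\<^sub>C (real ^ 'n)"
  assumes X: "compact (UNIV :: 'a set)" and T: "continuous_on UNIV T"
    and \<phi>s: "\<phi>s \<longlonglongrightarrow> \<phi>"
    and hs: "\<And>j::nat. hs j \<in> constraint_map (\<phi>s j) ` maximizing_measures T A \<phi> h"
  shows "(\<lambda>j. beta_fun T A (\<phi>s j) (hs j)) \<longlonglongrightarrow> beta_fun T A \<phi> h"
proof -
  let ?\<beta> = "\<lambda>j. beta_fun T A (\<phi>s j) (hs j)"
  have "\<exists>m. m \<in> maximizing_measures T A \<phi> h \<and> hs j = constraint_map (\<phi>s j) m" for j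
    using hs[of j] by blast
  then obtain \<mu> where \<mu>: "\<And>j. \<mu> j \<in> maximizing_measures T A \<phi> h"
    "\<And>j. hs j = constraint_map (\<phi>s j) (\<mu> j)"
    by metis
  have \<mu>_inv: "\<mu> j \<in> invariant_measures T" "constraint_map \<phi> (\<mu> j) = h"
    "(\<integral>x. apply_bcontfun A x \<partial>\<mu> j) = beta_fun T A \<phi> h" for j
    using \<mu>(1)[of j] by (auto simp: maximizing_measures_def constraint_fibre_def)
  have fibre: "\<mu> j \<in> constraint_fibre T (\<phi>s j) (hs j)" for j
    using \<mu>_inv(1) \<mu>(2) by (simp add: constraint_fibre_def)
  have lower: "beta_fun T A \<phi> h \<le> ?\<beta> j" for j
    using integral_le_beta_fun[OF fibre[of j], of A] \<mu>_inv(3)[of j] by simp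
  have upper: "\<forall>\<^sub>F j in sequentially. ?\<beta> j < beta_fun T A \<phi> h + e" if "e > 0" for e
  proof (rule ccontr)
    assume "\<not> ?thesis"
    then have "\<forall>n. \<exists>j\<ge>n. beta_fun T A \<phi> h + e \<le> ?\<beta> j"
      by (simp add: eventually_sequentially not_less)
    then have "infinite {j. beta_fun T A \<phi> h + e \<le> ?\<beta> j}"
      unfolding infinite_nat_iff_unbounded_le by simp
    then obtain s :: "nat \<Rightarrow> nat" where s: "strict_mono s"
      "\<And>i. beta_fun T A \<phi> h + e \<le> ?\<beta> (s i)"
      using infinite_enumerate by blast
    have "\<exists>\<nu> \<in> constraint_fibre T (\<phi>s (s i)) (hs (s i)).
        beta_fun T A \<phi> h + e / 2 < (\<integral>x. apply_bcontfun A x \<partial>\<nu>)" for i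
    proof (rule ccontr)
      assume "\<not> ?thesis"
      then have "?\<beta> (s i) \<le> beta_fun T A \<phi> h + e / 2"
        unfolding beta_fun_def[of T A "\<phi>s (s i)"] using fibre[of "s i"]
        by (intro cSUP_least) (auto simp: not_less)
      with s(2)[of i] \<open>e > 0\<close> show False by simp
    qed
    then obtain \<nu> where \<nu>: "\<And>i. \<nu> i \<in> constraint_fibre T (\<phi>s (s i)) (hs (s i))"
      "\<And>i. beta_fun T A \<phi> h + e / 2 < (\<integral>x. apply_bcontfun A x \<partial>\<nu> i)"
      by metis
    have \<nu>_inv: "\<nu> i \<in> invariant_measures T" "constraint_map (\<phi>s (s i)) (\<nu> i) = hs (s i)" for i
      using \<nu>(1)[of i] by (auto simp: constraint_fibre_def)
    obtain r \<nu>' where r: "strict_mono (r :: nat \<Rightarrow> nat)" and \<nu>': "\<nu>' \<in> invariant_measures T"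
      and limA: "(\<lambda>i. \<integral>x. apply_bcontfun A x \<partial>\<nu> (r i)) \<longlonglongrightarrow> (\<integral>x. apply_bcontfun A x \<partial>\<nu>')"
      and lim\<phi>: "(\<lambda>i. constraint_map \<phi> (\<nu> (r i))) \<longlonglongrightarrow> constraint_map \<phi> \<nu>'"
      using invariant_measures_convergent_subsequence_bcontfun
        [where \<mu> = \<nu> and A = A and \<psi> = \<phi>, OF X T \<nu>_inv(1)] by blast
    \<comment> \<open>Go through \<open>hs (s i)\<close>: it is the common value of \<open>\<phi>s (s i)\<close> at \<open>\<nu> i\<close> and at \<open>\<mu> (s i)\<close>.\<close>
    have bound: "dist (constraint_map \<phi> (\<nu> i)) h \<le> 2 * dist (\<phi>s (s i)) \<phi>" for i
    proof -
      have "dist (constraint_map \<phi> (\<nu> i)) h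
          \<le> dist (constraint_map \<phi> (\<nu> i)) (hs (s i)) + dist (hs (s i)) h"
        by (rule dist_triangle)
      also have "dist (constraint_map \<phi> (\<nu> i)) (hs (s i)) \<le> dist \<phi> (\<phi>s (s i))"
        using constraint_map_dist_le[OF \<nu>_inv(1)[of i], of \<phi> "\<phi>s (s i)"] \<nu>_inv(2) by simp
      also have "dist (hs (s i)) h \<le> dist (\<phi>s (s i)) \<phi>"
        using constraint_map_dist_le[OF \<mu>_inv(1)[of "s i"], of "\<phi>s (s i)" \<phi>] \<mu>_inv(2) \<mu>(2)
        by simp
      finally show ?thesis by (simp add: dist_commute)
    qed
    have null: "(\<lambda>i. 2 * dist (\<phi>s (s i)) \<phi>) \<longlonglongrightarrow> 0"
      using LIMSEQ_subseq_LIMSEQ[OF \<phi>s s(1)] tendsto_dist_iff[of "\<lambda>i. \<phi>s (s i)"]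
      by (auto intro!: tendsto_mult_right_zero simp: o_def)
    have "(\<lambda>i. dist (constraint_map \<phi> (\<nu> i)) h) \<longlonglongrightarrow> 0"
      by (rule tendsto_sandwich[OF always_eventually always_eventually tendsto_const null])
         (use bound in simp_all)
    then have "(\<lambda>i. constraint_map \<phi> (\<nu> i)) \<longlonglongrightarrow> h"
      by (subst tendsto_dist_iff)
    from LIMSEQ_subseq_LIMSEQ[OF this r] have "(\<lambda>i. constraint_map \<phi> (\<nu> (r i))) \<longlonglongrightarrow> h"
      by (simp add: o_def)
    with lim\<phi> have "constraint_map \<phi> \<nu>' = h" by (rule LIMSEQ_unique)
    then have "(\<integral>x. apply_bcontfun A x \<partial>\<nu>') \<le> beta_fun T A \<phi> h"
      using \<nu>' by (intro integral_le_beta_fun) (simp add: constraint_fibre_def)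
    moreover have "beta_fun T A \<phi> h + e / 2 \<le> (\<integral>x. apply_bcontfun A x \<partial>\<nu>')"
      using limA
    proof (rule LIMSEQ_le_const, intro exI allI impI)
      show "beta_fun T A \<phi> h + e / 2 \<le> (\<integral>x. apply_bcontfun A x \<partial>\<nu> (r i))" for i
        using \<nu>(2)[of "r i"] by simp
    qed
    ultimately show False using \<open>e > 0\<close> by simp
  qed
  show ?thesis
  proof (rule order_tendstoI)
    show "\<forall>\<^sub>F j in sequentially. a < ?\<beta> j" if "a < beta_fun T A \<phi> h" for a
      using that lower by (intro always_eventually) (auto intro: less_le_trans)
    show "\<forall>\<^sub>F j in sequentially. ?\<beta> j < a" if "beta_fun T A \<phi> h < a" for a
      using upper[of "a - beta_fun T A \<phi> h"] that by simp
  qed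
qed

section \<open>Lipschitz dependence of the alpha function\<close>

text \<open>
  An invariant measure that minimizes the right-hand side, which exists by compactness, is also optimal in its own fibre, so the beta value
  there is its \<open>A\<close>-integral. This exhibits a least element of the set whose minimum defines the alpha
  function.
\<close>

lemma alpha_fun_variational:
  fixes T :: "'a::metric_space \<Rightarrow> 'a" and A :: "'a \<Rightarrow>\<^sub>C real"
    and \<phi> :: "'a \<Rightarrow>\<^sub>C (real ^ 'n)" and c :: "real ^ 'n"
  assumes X: "compact (UNIV :: 'a set)" and T: "continuous_on UNIV T"
    and ne: "invariant_measures T \<noteq> {}"
  obtains \<mu> where "\<mu> \<in> invariant_measures T"
    and "alpha_fun T A \<phi> c = c \<bullet> constraint_map \<phi> \<mu> - (\<integral>x. apply_bcontfun A x \<partial>\<mu>)"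
    and "\<And>\<nu>. \<nu> \<in> invariant_measures T \<Longrightarrow>
           alpha_fun T A \<phi> c \<le> c \<bullet> constraint_map \<phi> \<nu> - (\<integral>x. apply_bcontfun A x \<partial>\<nu>)"
proof -
  define V where "V \<nu> = c \<bullet> constraint_map \<phi> \<nu> - (\<integral>x. apply_bcontfun A x \<partial>\<nu>)" for \<nu>
  have bdd: "bdd_below (V ` invariant_measures T)"
  proof (rule bdd_belowI2)
    fix \<nu> assume \<nu>: "\<nu> \<in> invariant_measures T"
    have "norm (constraint_map \<phi> \<nu>) \<le> norm \<phi>" "\<bar>\<integral>x. apply_bcontfun A x \<partial>\<nu>\<bar> \<le> norm A"
      using bcontfun_integral_norm_diff_le[OF \<nu>, of \<phi> 0] bcontfun_integral_norm_diff_le[OF \<nu>, of A 0]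
      by (simp_all add: constraint_map_eq_integral[OF \<nu>])
    moreover from this have "norm c * norm (constraint_map \<phi> \<nu>) \<le> norm c * norm \<phi>"
      by (simp add: mult_left_mono)
    moreover have "\<bar>c \<bullet> constraint_map \<phi> \<nu>\<bar> \<le> norm c * norm (constraint_map \<phi> \<nu>)"
      by (rule Cauchy_Schwarz_ineq2)
    ultimately show "- (norm c * norm \<phi>) - norm A \<le> V \<nu>" unfolding V_def by linarith
  qed
  define I where "I = (INF \<nu>\<in>invariant_measures T. V \<nu>)"
  have "\<exists>\<nu>\<in>invariant_measures T. V \<nu> < I + inverse (real (Suc j))" for j
    using cInf_lessD[of "V ` invariant_measures T" "I + inverse (real (Suc j))"] ne
    by (auto simp: I_def)
  then obtain \<nu> where \<nu>: "\<And>j. \<nu> j \<in> invariant_measures T"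
    "\<And>j. V (\<nu> j) < I + inverse (real (Suc j))"
    by metis
  obtain r \<mu> where r: "strict_mono (r :: nat \<Rightarrow> nat)" and \<mu>: "\<mu> \<in> invariant_measures T"
    and limA: "(\<lambda>i. \<integral>x. apply_bcontfun A x \<partial>\<nu> (r i)) \<longlonglongrightarrow> (\<integral>x. apply_bcontfun A x \<partial>\<mu>)"
    and lim\<phi>: "(\<lambda>i. constraint_map \<phi> (\<nu> (r i))) \<longlonglongrightarrow> constraint_map \<phi> \<mu>"
    using invariant_measures_convergent_subsequence_bcontfun
        [where \<mu> = \<nu> and A = A and \<psi> = \<phi>, OF X T \<nu>(1)] by blast
  have "(\<lambda>j. V (\<nu> (r j))) \<longlonglongrightarrow> V \<mu>"
    unfolding V_def by (intro tendsto_intros limA lim\<phi>)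
  moreover have "(\<lambda>j. I + inverse (real (Suc (r j)))) \<longlonglongrightarrow> I"
    using LIMSEQ_subseq_LIMSEQ[OF LIMSEQ_inverse_real_of_nat_add[of I] r] by (simp add: o_def)
  ultimately have "V \<mu> \<le> I"
    using \<nu>(2) by (intro LIMSEQ_le) (auto intro: less_imp_le)
  then have min: "V \<mu> \<le> V \<nu>" if "\<nu> \<in> invariant_measures T" for \<nu>
    using cINF_lower[OF bdd that] unfolding I_def by simp
  have beta_le: "beta_fun T A \<phi> (constraint_map \<phi> \<nu>) \<le> c \<bullet> constraint_map \<phi> \<nu> - V \<mu>"
    if "\<nu> \<in> invariant_measures T" for \<nu>
    unfolding beta_fun_def
  proof (rule cSUP_least)
    show "constraint_fibre T \<phi> (constraint_map \<phi> \<nu>) \<noteq> {}"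
      using that by (auto simp: constraint_fibre_def)
    fix \<rho> assume "\<rho> \<in> constraint_fibre T \<phi> (constraint_map \<phi> \<nu>)"
    then have "\<rho> \<in> invariant_measures T" "constraint_map \<phi> \<rho> = constraint_map \<phi> \<nu>"
      by (auto simp: constraint_fibre_def)
    with min[of \<rho>] show "(\<integral>x. apply_bcontfun A x \<partial>\<rho>) \<le> c \<bullet> constraint_map \<phi> \<nu> - V \<mu>"
      by (simp add: V_def)
  qed
  have beta_eq: "beta_fun T A \<phi> (constraint_map \<phi> \<mu>) = (\<integral>x. apply_bcontfun A x \<partial>\<mu>)"
    using beta_le[OF \<mu>] integral_le_beta_fun[of \<mu> T \<phi> "constraint_map \<phi> \<mu>" A] \<mu>
    by (auto simp: V_def constraint_fibre_def intro: antisym)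
  have "alpha_fun T A \<phi> c = V \<mu>"
    unfolding alpha_fun_def
  proof (rule Least_equality)
    show "V \<mu> \<in> (\<lambda>h. c \<bullet> h - beta_fun T A \<phi> h) ` (constraint_map \<phi> ` invariant_measures T)"
      by (rule image_eqI[OF _ imageI[OF \<mu>]]) (simp add: V_def beta_eq)
    fix y assume "y \<in> (\<lambda>h. c \<bullet> h - beta_fun T A \<phi> h) ` (constraint_map \<phi> ` invariant_measures T)"
    then show "V \<mu> \<le> y" using beta_le by force
  qed
  then show ?thesis using that[OF \<mu>] min by (simp add: V_def)
qed

lemma alpha_fun_lipschitz:
  fixes T :: "'a::metric_space \<Rightarrow> 'a" and A :: "'a \<Rightarrow>\<^sub>C real" and c :: "real ^ 'n"
  assumes X: "compact (UNIV :: 'a set)" and T: "continuous_on UNIV T"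
  shows "(norm c)-lipschitz_on UNIV (\<lambda>\<phi> :: 'a \<Rightarrow>\<^sub>C (real ^ 'n). alpha_fun T A \<phi> c)"
proof (cases "invariant_measures T = {}")
  case True
  \<comment> \<open>The minimum is then over the empty set for every constraint, so it is a constant.\<close>
  then show ?thesis
    by (intro lipschitz_onI) (simp_all add: alpha_fun_def)
next
  case False
  have le: "alpha_fun T A \<phi> c - alpha_fun T A \<psi> c \<le> norm c * dist \<phi> \<psi>"
    for \<phi> \<psi> :: "'a \<Rightarrow>\<^sub>C (real ^ 'n)"
  proof -
    \<comment> \<open>Test the minimum for \<open>\<phi>\<close> with the minimizer for \<open>\<psi>\<close>.\<close>
    obtain \<mu> where \<mu>: "\<mu> \<in> invariant_measures T"
      "alpha_fun T A \<psi> c = c \<bullet> constraint_map \<psi> \<mu> - (\<integral>x. apply_bcontfun A x \<partial>\<mu>)"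
      using alpha_fun_variational[OF X T False, of A \<psi> c] by metis
    have "alpha_fun T A \<phi> c \<le> c \<bullet> constraint_map \<phi> \<mu> - (\<integral>x. apply_bcontfun A x \<partial>\<mu>)"
      using alpha_fun_variational[OF X T False, of A \<phi> c] \<mu>(1) by metis
    then have "alpha_fun T A \<phi> c - alpha_fun T A \<psi> c
        \<le> c \<bullet> (constraint_map \<phi> \<mu> - constraint_map \<psi> \<mu>)"
      unfolding \<mu>(2) by (simp add: inner_diff_right)
    also have "\<dots> \<le> norm c * dist (constraint_map \<phi> \<mu>) (constraint_map \<psi> \<mu>)"
      unfolding dist_norm by (rule norm_cauchy_schwarz)
    also have "\<dots> \<le> norm c * dist \<phi> \<psi>"
      by (intro mult_left_mono constraint_map_dist_le[OF \<mu>(1)]) simp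
    finally show ?thesis .
  qed
  show ?thesis
  proof (rule lipschitz_onI)
    fix \<phi> \<psi> :: "'a \<Rightarrow>\<^sub>C (real ^ 'n)"
    show "dist (alpha_fun T A \<phi> c) (alpha_fun T A \<psi> c) \<le> norm c * dist \<phi> \<psi>"
      using le[of \<phi> \<psi>] le[of \<psi> \<phi>] by (simp add: dist_real_def abs_le_iff dist_commute)
  qed simp
qed

theorem proposition7:
  fixes T :: "'a::metric_space \<Rightarrow> 'a"
    and A :: "'a \<Rightarrow>\<^sub>C real"
  assumes "compact (UNIV :: 'a set)"
    and "continuous_on UNIV T"
  shows "(\<forall>(\<phi> :: 'a \<Rightarrow>\<^sub>C (real ^ 'n)) h \<phi>s hs.
            h \<in> constraint_map \<phi> ` invariant_measures T \<longrightarrow>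
            \<phi>s \<longlonglongrightarrow> \<phi> \<longrightarrow>
            (\<forall>j::nat. hs j \<in> constraint_map (\<phi>s j) ` maximizing_measures T A \<phi> h) \<longrightarrow>
            (\<lambda>j. beta_fun T A (\<phi>s j) (hs j)) \<longlonglongrightarrow> beta_fun T A \<phi> h)
       \<and> (\<forall>c :: real ^ 'n.
            (norm c)-lipschitz_on UNIV (\<lambda>\<phi> :: 'a \<Rightarrow>\<^sub>C (real ^ 'n). alpha_fun T A \<phi> c))"
  using beta_fun_tendsto[OF assms] alpha_fun_lipschitz[OF assms] by blast

end
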